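(* The functional $F\mapsto \mathcal{I}_{\rm s1}(F)\in[0,\infty]$, defined on the set of all probability distributions $F$ on the real line, is weakly lower semicontinuous (that is, lower semicontinuous with respect to weak convergence of probability measures) and convex.
   Context: Let $\mathcal{C}_{\rm c1}$ denote the set of all differentiable functions $\phi\colon\mathbb{R}\to\mathbb{R}$ whose derivative $\phi'$ is continuous and of compact support (the function $\phi$ itself need not have compact support). For any probability distribution $F$ on the Borel $\sigma$-algebra of $\mathbb{R}$, the Fisher information of scale is $$\mathcal{I}_{\rm s1}(F):=\sup_{\phi\in\mathcal{C}_{\rm c1}}\frac{\bigl(\int x\,\phi'(x)\,F(dx)\bigr)^2}{\int\phi^2(x)\,F(dx)},$$ where by convention $0/0:=0$, and $c/0:=\infty$ for $c>0$. *)

theory Defs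
  imports "HOL-Probability.Probability"
begin

definition C_c1 :: "(real \<Rightarrow> real) set" where
  "C_c1 = {\<phi>. (\<forall>x. \<phi> differentiable at x) \<and> continuous_on UNIV (deriv \<phi>)
             \<and> compact (closure (support_on UNIV (deriv \<phi>)))}"

text \<open>
  For \<open>\<phi> \<in> C_c1\<close> the functions \<open>x * \<phi>' x\<close> and \<open>\<phi>\<^sup>2\<close> are bounded and continuous, so both
  Bochner integrals below are genuine integrals. Division in \<^typ>\<open>ennreal\<close> satisfies
  \<open>0 / 0 = 0\<close> and \<open>c / 0 = \<infinity>\<close> for \<open>c > 0\<close>, see \<open>ennreal_ratio_conventions\<close>.
\<close>
definition fisher_info_scale :: "real measure \<Rightarrow> ennreal" where
  "fisher_info_scale F =
     (SUP \<phi>\<in>C_c1. ennreal ((\<integral>x. x * deriv \<phi> x \<partial>F)\<^sup>2) / ennreal (\<integral>x. (\<phi> x)\<^sup>2 \<partial>F))"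

lemma ennreal_ratio_conventions:
  "(0::ennreal) / 0 = 0" "(c::ennreal) > 0 \<Longrightarrow> c / 0 = \<infinity>"
  by (simp_all add: divide_ennreal_def ennreal_mult_top)

text \<open>
  The weak topology on the set of all probability distributions on the line: the coarsest
  topology making \<open>F \<mapsto> \<integral>f dF\<close> continuous for every bounded continuous \<open>f\<close>. The choice
  \<open>f = 0\<close>, \<open>U = UNIV\<close> shows that its carrier consists of all distributions.
\<close>
definition weak_topology :: "real measure topology" where
  "weak_topology = topology_generated_by
     {{F. real_distribution F \<and> (\<integral>x. f x \<partial>F) \<in> U} | (f :: real \<Rightarrow> real) U.
        continuous_on UNIV f \<and> bounded (range f) \<and> open U}"

definition lower_semicontinuous_map :: "'a topology \<Rightarrow> ('a \<Rightarrow> 'b::linorder) \<Rightarrow> bool" where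
  "lower_semicontinuous_map X f \<longleftrightarrow> (\<forall>a. openin X {x \<in> topspace X. a < f x})"

text \<open>The convex combination \<open>(1 - t) F + t G\<close>.\<close>
definition mixture :: "real \<Rightarrow> real measure \<Rightarrow> real measure \<Rightarrow> real measure" where
  "mixture t F G = measure_of UNIV (sets borel)
     (\<lambda>A. ennreal (1 - t) * emeasure F A + ennreal t * emeasure G A)"

lemma topspace_weak_topology: "topspace weak_topology = {F. real_distribution F}"
proof -
  have "{F. real_distribution F} \<in> {{F. real_distribution F \<and> (\<integral>x. f x \<partial>F) \<in> U} | (f :: real \<Rightarrow> real) U.
        continuous_on UNIV f \<and> bounded (range f) \<and> open U}"
    by (intro CollectI exI[of _ "\<lambda>_. 0"] exI[of _ UNIV]) auto
  then show ?thesis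
    unfolding weak_topology_def topology_generated_by_topspace by blast
qed

lemma limitin_weak_topology_iff:
  assumes "real_distribution F"
  shows "limitin weak_topology S F net \<longleftrightarrow>
    (\<forall>\<^sub>F i in net. real_distribution (S i)) \<and>
    (\<forall>f :: real \<Rightarrow> real. continuous_on UNIV f \<longrightarrow> bounded (range f) \<longrightarrow>
       ((\<lambda>i. \<integral>x. f x \<partial>S i) \<longlongrightarrow> (\<integral>x. f x \<partial>F)) net)" (is "?L \<longleftrightarrow> ?R")
proof
  assume L: ?L
  have sub: "\<forall>\<^sub>F i in net. real_distribution (S i) \<and> (\<integral>x. f x \<partial>S i) \<in> U"
    if "continuous_on UNIV f" "bounded (range f)" "open U" "(\<integral>x. f x \<partial>F) \<in> U"
    for f :: "real \<Rightarrow> real" and U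
  proof -
    have "openin weak_topology {F. real_distribution F \<and> (\<integral>x. f x \<partial>F) \<in> U}"
      unfolding weak_topology_def using that by (intro topology_generated_by_Basis) blast
    then show ?thesis
      using L assms that(4) unfolding limitin_def by force
  qed
  show ?R
  proof (intro conjI allI impI)
    show "\<forall>\<^sub>F i in net. real_distribution (S i)"
      using sub[of "\<lambda>_. 0" UNIV] by auto
  next
    fix f :: "real \<Rightarrow> real"
    assume "continuous_on UNIV f" "bounded (range f)"
    then show "((\<lambda>i. \<integral>x. f x \<partial>S i) \<longlongrightarrow> (\<integral>x. f x \<partial>F)) net"
      by (intro topological_tendstoI) (rule eventually_mono[OF sub], auto)
  qed
next
  assume R: ?R
  have "\<forall>\<^sub>F i in net. S i \<in> V"
    if "generate_topology_on {{F. real_distribution F \<and> (\<integral>x. f x \<partial>F) \<in> U} | (f :: real \<Rightarrow> real) U.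
        continuous_on UNIV f \<and> bounded (range f) \<and> open U} V" "F \<in> V" for V
    using that
  proof (induction rule: generate_topology_on.induct)
    case Empty
    then show ?case by simp
  next
    case (Int a b)
    then show ?case by (auto intro: eventually_conj)
  next
    case (UN K)
    then obtain k where "k \<in> K" "F \<in> k" by blast
    with UN.IH have "\<forall>\<^sub>F i in net. S i \<in> k" by blast
    then show ?case by eventually_elim (use \<open>k \<in> K\<close> in blast)
  next
    case (Basis s)
    then obtain f :: "real \<Rightarrow> real" and U where
      s: "s = {F. real_distribution F \<and> (\<integral>x. f x \<partial>F) \<in> U}"
      and f: "continuous_on UNIV f" "bounded (range f)" "open U" by blast
    then have "\<forall>\<^sub>F i in net. (\<integral>x. f x \<partial>S i) \<in> U"
      using R Basis.prems by (intro topological_tendstoD) auto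
    with R show ?case unfolding s by (auto intro: eventually_conj)
  qed
  then show ?L
    using assms topspace_weak_topology
    by (auto simp: limitin_def weak_topology_def openin_topology_generated_by_iff)
qed

text \<open>Sequential convergence in this topology is the library's weak convergence.\<close>
lemma limitin_weak_topology_sequentially_iff_weak_conv_m:
  assumes S: "\<And>n. real_distribution (S n)" and F: "real_distribution F"
  shows "limitin weak_topology S F sequentially \<longleftrightarrow> weak_conv_m S F"
proof
  assume "limitin weak_topology S F sequentially"
  then show "weak_conv_m S F"
    unfolding limitin_weak_topology_iff[OF F]
    by (intro integral_bdd_continuous_conv_imp_weak_conv S F)
       (auto simp: continuous_on_eq_continuous_at bounded_iff)
next
  assume W: "weak_conv_m S F"
  have "(\<lambda>n. \<integral>x. f x \<partial>S n) \<longlonglongrightarrow> (\<integral>x. f x \<partial>F)"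
    if cont: "continuous_on UNIV f" and bdd: "bounded (range f)" for f :: "real \<Rightarrow> real"
  proof -
    obtain B where "\<And>x. norm (f x) \<le> B"
      using bdd by (auto simp: bounded_iff)
    then show ?thesis
      using cont by (intro weak_conv_imp_integral_bdd_continuous_conv[OF S F W])
        (auto simp: continuous_on_eq_continuous_at)
  qed
  then show "limitin weak_topology S F sequentially"
    unfolding limitin_weak_topology_iff[OF F] using S by auto
qed

lemma sets_mixture [simp, measurable_cong]: "sets (mixture t F G) = sets borel"
  by (simp add: mixture_def sets.sigma_sets_eq[of borel, simplified])

lemma emeasure_mixture:
  assumes F: "real_distribution F" and G: "real_distribution G" and A: "A \<in> sets borel"
  shows "emeasure (mixture t F G) A = ennreal (1 - t) * emeasure F A + ennreal t * emeasure G A"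
proof -
  have s: "sets F = sets borel" "sets G = sets borel"
    using F G by (auto simp: real_distribution.events_eq_borel)
  have "countably_additive (sets borel)
      (\<lambda>A. ennreal (1 - t) * emeasure F A + ennreal t * emeasure G A)"
  proof (rule countably_additiveI)
    fix B :: "nat \<Rightarrow> real set"
    assume B: "range B \<subseteq> sets borel" "disjoint_family B" "(\<Union>i. B i) \<in> sets borel"
    have "(\<Sum>i. ennreal (1 - t) * emeasure F (B i) + ennreal t * emeasure G (B i))
        = ennreal (1 - t) * (\<Sum>i. emeasure F (B i)) + ennreal t * (\<Sum>i. emeasure G (B i))"
      by (simp add: suminf_add[symmetric])
    also have "\<dots> = ennreal (1 - t) * emeasure F (\<Union>i. B i) + ennreal t * emeasure G (\<Union>i. B i)"
      using B s by (simp add: suminf_emeasure)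
    finally show "(\<Sum>i. ennreal (1 - t) * emeasure F (B i) + ennreal t * emeasure G (B i))
        = ennreal (1 - t) * emeasure F (\<Union>i. B i) + ennreal t * emeasure G (\<Union>i. B i)" .
  qed
  moreover have "sigma_algebra UNIV (sets (borel :: real measure))"
    using sets.sigma_algebra_axioms[of "borel :: real measure"] by simp
  ultimately show ?thesis
    unfolding mixture_def using A
    by (intro emeasure_measure_of_sigma) (auto simp: positive_def)
qed

lemma real_distribution_mixture:
  assumes "real_distribution F" "real_distribution G" "0 \<le> t" "t \<le> 1"
  shows "real_distribution (mixture t F G)"
proof -
  interpret F: real_distribution F by fact
  interpret G: real_distribution G by fact
  have "emeasure (mixture t F G) UNIV = ennreal (1 - t) + ennreal t"
    using assms F.emeasure_space_1 G.emeasure_space_1 by (simp add: emeasure_mixture)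
  also have "\<dots> = 1"
    using assms by (simp flip: ennreal_plus)
  finally have "prob_space (mixture t F G)"
    by (intro prob_spaceI) (simp add: mixture_def space_measure_of_conv)
  then show ?thesis
    by (simp add: real_distribution_def real_distribution_axioms_def)
qed

end

theory Submission
  imports Defs
begin

text \<open>
  Since \<open>n\<^sup>2 / d = sup\<^sub>c (2 c n - c\<^sup>2 d)\<close>, conventions for \<open>d = 0\<close> included, and \<open>C_c1\<close> is closed
  under scaling, the Fisher information is \<open>\<I>(F) = sup\<^sub>\<phi> \<integral>(2 x \<phi>'(x) - \<phi>(x)\<^sup>2) F(dx)\<close>. This is a
  supremum of functionals that are affine in \<open>F\<close> and, the integrands being bounded and continuous,
  weakly continuous.
\<close>

section \<open>Regularity, scaling and boundedness of the test functions\<close>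

lemma C_c1_D:
  assumes "\<phi> \<in> C_c1"
  shows "\<phi> differentiable at x" "continuous_on UNIV (deriv \<phi>)"
    and "compact (closure (support_on UNIV (deriv \<phi>)))"
  using assms by (auto simp: C_c1_def)

lemma C_c1_derivative:
  assumes "\<phi> \<in> C_c1"
  shows "(\<phi> has_real_derivative deriv \<phi> x) (at x)"
  using C_c1_D(1)[OF assms] by (simp add: DERIV_deriv_iff_real_differentiable)

lemma C_c1_continuous:
  assumes "\<phi> \<in> C_c1"
  shows "continuous_on UNIV \<phi>"
  using C_c1_derivative[OF assms] by (auto intro!: continuous_at_imp_continuous_on DERIV_isCont)

lemma deriv_scale:
  assumes "\<phi> \<in> C_c1"
  shows "deriv (\<lambda>x. c * \<phi> x) x = c * deriv \<phi> x"
  by (rule DERIV_imp_deriv[OF DERIV_cmult[OF C_c1_derivative[OF assms]]])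

lemma C_c1_scale:
  assumes "\<phi> \<in> C_c1"
  shows "(\<lambda>x. c * \<phi> x) \<in> C_c1"
proof -
  have d: "deriv (\<lambda>x. c * \<phi> x) = (\<lambda>x. c * deriv \<phi> x)"
    using deriv_scale[OF assms] by auto
  \<comment> \<open>An inclusion rather than an equality, because \<open>c = 0\<close> empties the
    support; a closed subset of a compact set is compact.\<close>
  have "closure (support_on UNIV (\<lambda>x. c * deriv \<phi> x)) \<subseteq> closure (support_on UNIV (deriv \<phi>))"
    by (intro closure_mono) (auto simp: support_on_def)
  then have "compact (closure (support_on UNIV (\<lambda>x. c * deriv \<phi> x)))"
    using C_c1_D(3)[OF assms] by (metis closed_closure compact_Int_closed inf.absorb_iff2)
  then show ?thesis
    using C_c1_D[OF assms] by (auto simp: C_c1_def d simp del: compact_closure intro!: continuous_intros)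
qed

text \<open>Replaces the topological support condition by a radius, the form in which the
  boundedness proofs use it.\<close>

lemma C_c1_deriv_eq_0:
  assumes "\<phi> \<in> C_c1"
  obtains R where "R \<ge> 0" "\<And>x. \<bar>x\<bar> > R \<Longrightarrow> deriv \<phi> x = 0"
proof -
  have "bounded (support_on UNIV (deriv \<phi>))"
    using C_c1_D(3)[OF assms] by (meson bounded_subset closure_subset compact_imp_bounded)
  then obtain R where R: "\<And>x. deriv \<phi> x \<noteq> 0 \<Longrightarrow> \<bar>x\<bar> \<le> R"
    by (auto simp: bounded_iff support_on_def)
  show ?thesis
    by (rule that[of "max R 0"]) (use R in force)+
qed

lemma bounded_range_if_bounded_outside:
  fixes f :: "real \<Rightarrow> real"
  assumes "continuous_on UNIV f" and "\<And>x. \<bar>x\<bar> > R \<Longrightarrow> f x \<in> B" and "bounded B"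
  shows "bounded (range f)"
proof -
  have "compact (f ` cball 0 R)"
    using assms(1) by (intro compact_continuous_image) (auto intro: continuous_on_subset)
  then have "bounded (f ` cball 0 R \<union> B)"
    using assms(3) by (simp add: compact_imp_bounded)
  moreover have "range f \<subseteq> f ` cball 0 R \<union> B"
  proof clarify
    fix x assume "f x \<notin> B"
    then have "\<not> \<bar>x\<bar> > R"
      using assms(2) by blast
    then show "f x \<in> f ` cball 0 R"
      by (intro imageI) auto
  qed
  ultimately show ?thesis
    by (rule bounded_subset)
qed

text \<open>Although \<open>\<phi>\<close> need not vanish at infinity, it is constant on each of
  the two half-lines beyond the support of its derivative. The two constants may differ, hence the
  two-point set of outer values.\<close>

lemma C_c1_bounded:
  assumes "\<phi> \<in> C_c1"
  shows "bounded (range \<phi>)"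
proof -
  obtain R where R: "R \<ge> 0" "\<And>x. \<bar>x\<bar> > R \<Longrightarrow> deriv \<phi> x = 0"
    using C_c1_deriv_eq_0[OF assms] by blast
  have "\<phi> x \<in> {\<phi> R, \<phi> (- R)}" if "\<bar>x\<bar> > R" for x
  proof (cases "x > R")
    case True
    have "\<phi> x = \<phi> R"
      by (rule DERIV_isconst2[of R x \<phi>])
        (use True R(1) in \<open>auto intro!: continuous_on_subset[OF C_c1_continuous[OF assms]]
          DERIV_cong[OF C_c1_derivative[OF assms] R(2)]\<close>)
    then show ?thesis by simp
  next
    case False
    then have "x < - R" using that by linarith
    have "\<phi> (- R) = \<phi> x"
      by (rule DERIV_isconst2[of x "- R" \<phi>])
        (use \<open>x < - R\<close> R(1) in \<open>auto intro!: continuous_on_subset[OF C_c1_continuous[OF assms]]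
          DERIV_cong[OF C_c1_derivative[OF assms] R(2)]\<close>)
    then show ?thesis by simp
  qed
  then show ?thesis
    by (intro bounded_range_if_bounded_outside[of \<phi> R "{\<phi> R, \<phi> (- R)}"] C_c1_continuous assms) auto
qed

lemma continuous_score:
  assumes "\<phi> \<in> C_c1"
  shows "continuous_on UNIV (\<lambda>x. x * deriv \<phi> x)"
  by (intro continuous_intros C_c1_D(2) assms)

lemma bounded_score:
  assumes "\<phi> \<in> C_c1"
  shows "bounded (range (\<lambda>x. x * deriv \<phi> x))"
proof -
  obtain R where R: "\<And>x. \<bar>x\<bar> > R \<Longrightarrow> deriv \<phi> x = 0"
    using C_c1_deriv_eq_0[OF assms] by blast
  show ?thesis
    by (rule bounded_range_if_bounded_outside[of _ R "{0}"]) (auto simp: R continuous_score[OF assms])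
qed

lemma bounded_power2:
  assumes "\<phi> \<in> C_c1"
  shows "bounded (range (\<lambda>x. (\<phi> x)\<^sup>2))"
proof -
  obtain B where B: "\<And>x. \<bar>\<phi> x\<bar> \<le> B"
    using C_c1_bounded[OF assms] by (auto simp: bounded_iff)
  have "norm ((\<phi> x)\<^sup>2) \<le> B\<^sup>2" for x
    using power_mono[OF B abs_ge_zero, of x 2] by simp
  then show ?thesis
    unfolding bounded_iff by auto
qed

lemma integrable_bounded_continuous:
  fixes f :: "real \<Rightarrow> real"
  assumes "real_distribution F" "continuous_on UNIV f" "bounded (range f)"
  shows "integrable F f"
proof -
  interpret real_distribution F by fact
  obtain B where "\<And>x. norm (f x) \<le> B"
    using assms(3) by (auto simp: bounded_iff)
  then show ?thesis
    using borel_measurable_continuous_onI[OF assms(2)]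
    by (intro integrable_const_bound[of _ B]) (auto simp: measurable_cong_sets[OF events_eq_borel refl])
qed

section \<open>The information as a supremum of integrals\<close>

definition score_gap :: "(real \<Rightarrow> real) \<Rightarrow> real \<Rightarrow> real" where
  "score_gap \<phi> x = 2 * (x * deriv \<phi> x) - (\<phi> x)\<^sup>2"

lemma continuous_score_gap: "\<phi> \<in> C_c1 \<Longrightarrow> continuous_on UNIV (score_gap \<phi>)"
  unfolding score_gap_def by (intro continuous_intros continuous_score C_c1_continuous C_c1_D(2))

lemma bounded_score_gap:
  assumes "\<phi> \<in> C_c1"
  shows "bounded (range (score_gap \<phi>))"
  unfolding score_gap_def using bounded_score[OF assms]
  by (intro bounded_minus_comp bounded_power2 assms)
     (use bounded_scaleR_comp[of "\<lambda>x. x * deriv \<phi> x" UNIV 2] in simp)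

text \<open>Along the multiples of a fixed \<open>\<phi>\<close> the integral is a quadratic
  polynomial in \<open>c\<close>; its coefficients are the two integrals in the ratio defining the
  information.\<close>

lemma integral_score_gap_scale:
  assumes "real_distribution F" "\<phi> \<in> C_c1"
  shows "(\<integral>x. score_gap (\<lambda>x. c * \<phi> x) x \<partial>F)
    = 2 * c * (\<integral>x. x * deriv \<phi> x \<partial>F) - c\<^sup>2 * (\<integral>x. (\<phi> x)\<^sup>2 \<partial>F)"
proof -
  have "integrable F (\<lambda>x. x * deriv \<phi> x)"
    using assms by (intro integrable_bounded_continuous continuous_score bounded_score)
  moreover have "integrable F (\<lambda>x. (\<phi> x)\<^sup>2)"
    using assms by (intro integrable_bounded_continuous continuous_intros C_c1_continuous bounded_power2)
  moreover have "score_gap (\<lambda>x. c * \<phi> x) x = 2 * c * (x * deriv \<phi> x) - c\<^sup>2 * (\<phi> x)\<^sup>2" for x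
    by (simp add: score_gap_def deriv_scale[OF assms(2)] power_mult_distrib)
  ultimately show ?thesis
    by simp
qed

text \<open>For \<open>d > 0\<close> complete the square: the ratio exceeds each term by
  \<open>(n - c * d)\<^sup>2 / d\<close>, which vanishes at \<open>c = n / d\<close>. For
  \<open>d = 0\<close> the terms \<open>2 * c * n\<close> are unbounded in \<open>c\<close> unless
  \<open>n = 0\<close>, in agreement with the conventions for division by zero. Truncation of
  negative terms by \<open>ennreal\<close> is harmless, since \<open>c = 0\<close> already gives
  0.\<close>

lemma ennreal_sq_div_eq_SUP:
  fixes n d :: real
  assumes d: "d \<ge> 0"
  shows "ennreal (n\<^sup>2) / ennreal d = (SUP c. ennreal (2 * c * n - c\<^sup>2 * d))"
proof (cases "d = 0")
  case False
  then have d: "d > 0" using d by simp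
  have "2 * c * n - c\<^sup>2 * d \<le> n\<^sup>2 / d" for c
  proof -
    have "n\<^sup>2 / d - (2 * c * n - c\<^sup>2 * d) = (n - c * d)\<^sup>2 / d"
      using d by (simp add: field_simps power2_eq_square)
    also have "\<dots> \<ge> 0" using d by simp
    finally show ?thesis by simp
  qed
  moreover have "2 * (n / d) * n - (n / d)\<^sup>2 * d = n\<^sup>2 / d"
    using d by (simp add: field_simps power2_eq_square)
  ultimately show ?thesis
    unfolding divide_ennreal[OF zero_le_power2 d]
    by (intro antisym SUP_least ennreal_leI SUP_upper2[of "n / d"]) auto
next
  case True
  show ?thesis
  proof (cases "n = 0")
    case False
    have "(SUP c. ennreal (2 * c * n - c\<^sup>2 * d)) = top"
    proof (rule ennreal_SUP_eq_top)
      fix m :: nat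
      \<comment> \<open>The witness solves \<open>2 * c * n = m\<close>; the quadratic term vanishes
        with \<open>d\<close>.\<close>
      have "of_nat m \<le> ennreal (2 * (m / (2 * n)) * n - (m / (2 * n))\<^sup>2 * d)"
        using False True by (simp add: ennreal_of_nat_eq_real_of_nat)
      then show "\<exists>c\<in>UNIV. of_nat m \<le> ennreal (2 * c * n - c\<^sup>2 * d)"
        by blast
    qed
    moreover have "ennreal (n\<^sup>2) / ennreal d = top"
      using ennreal_ratio_conventions(2)[of "ennreal (n\<^sup>2)"] True False by simp
    ultimately show ?thesis
      by (simp only:)
  qed (use True in simp)
qed

text \<open>Each ratio is a supremum over the multiples of \<open>\<phi>\<close>. These stay in
  \<open>C_c1\<close>, which gives one inequality; the multiple with \<open>c = 1\<close> gives the
  other.\<close>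

lemma fisher_info_scale_eq_SUP:
  assumes F: "real_distribution F"
  shows "fisher_info_scale F = (SUP \<phi>\<in>C_c1. ennreal (\<integral>x. score_gap \<phi> x \<partial>F))"
proof -
  have ratio: "ennreal ((\<integral>x. x * deriv \<phi> x \<partial>F)\<^sup>2) / ennreal (\<integral>x. (\<phi> x)\<^sup>2 \<partial>F)
      = (SUP c. ennreal (\<integral>x. score_gap (\<lambda>x. c * \<phi> x) x \<partial>F))" if "\<phi> \<in> C_c1" for \<phi>
    by (simp add: ennreal_sq_div_eq_SUP integral_score_gap_scale[OF F that])
  show ?thesis
  proof (rule antisym)
    show "fisher_info_scale F \<le> (SUP \<phi>\<in>C_c1. ennreal (\<integral>x. score_gap \<phi> x \<partial>F))"
      unfolding fisher_info_scale_def
      by (intro SUP_least) (auto simp: ratio intro!: SUP_least SUP_upper2[OF C_c1_scale])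
    show "(SUP \<phi>\<in>C_c1. ennreal (\<integral>x. score_gap \<phi> x \<partial>F)) \<le> fisher_info_scale F"
      unfolding fisher_info_scale_def
      by (intro SUP_mono) (auto simp: ratio intro!: bexI SUP_upper2[of 1])
  qed
qed

section \<open>Weak lower semicontinuity\<close>

lemma continuous_map_weak_topology_integral:
  fixes f :: "real \<Rightarrow> real"
  assumes "continuous_on UNIV f" "bounded (range f)"
  shows "continuous_map weak_topology euclideanreal (\<lambda>F. \<integral>x. f x \<partial>F)"
  unfolding continuous_map_def topspace_weak_topology
proof (intro conjI allI impI)
  fix U :: "real set"
  assume "openin euclideanreal U"
  then have "openin weak_topology {F. real_distribution F \<and> (\<integral>x. f x \<partial>F) \<in> U}"
    unfolding weak_topology_def using assms by (intro topology_generated_by_Basis) auto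
  then show "openin weak_topology {F \<in> {F. real_distribution F}. (\<integral>x. f x \<partial>F) \<in> U}"
    by simp
qed simp

lemma openin_less_integral:
  fixes f :: "real \<Rightarrow> real"
  assumes "continuous_on UNIV f" "bounded (range f)"
  shows "openin weak_topology {F \<in> topspace weak_topology. a < ennreal (\<integral>x. f x \<partial>F)}"
proof (rule openin_continuous_map_preimage[OF continuous_map_weak_topology_integral[OF assms],
      of "{y. a < ennreal y}", simplified])
  show "open {y. a < ennreal y}"
    by (intro open_Collect_less continuous_intros continuous_on_ennreal)
qed

text \<open>A supremum exceeds \<open>a\<close> exactly when one of its members does, so the
  superlevel set is a union of open ones. Intersecting with \<open>topspace\<close> keeps
  \<open>F\<close> a distribution, as the supremum formula requires.\<close>

lemma lower_semicontinuous_fisher_info_scale: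
  "lower_semicontinuous_map weak_topology fisher_info_scale"
  unfolding lower_semicontinuous_map_def
proof
  fix a
  have "{F \<in> topspace weak_topology. a < fisher_info_scale F}
      = (\<Union>\<phi>\<in>C_c1. {F \<in> topspace weak_topology. a < ennreal (\<integral>x. score_gap \<phi> x \<partial>F)})"
    by (auto simp: topspace_weak_topology fisher_info_scale_eq_SUP less_SUP_iff)
  also have "openin weak_topology \<dots>"
    by (auto intro!: openin_less_integral continuous_score_gap bounded_score_gap)
  finally show "openin weak_topology {F \<in> topspace weak_topology. a < fisher_info_scale F}" .
qed

section \<open>Integration against mixtures, and convexity\<close>

lemma nn_integral_mixture:
  assumes F: "real_distribution F" and G: "real_distribution G" and "f \<in> borel_measurable borel"
  shows "(\<integral>\<^sup>+x. f x \<partial>mixture t F G) = ennreal (1 - t) * (\<integral>\<^sup>+x. f x \<partial>F) + ennreal t * (\<integral>\<^sup>+x. f x \<partial>G)"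
proof -
  have [measurable_cong, simp]: "sets F = sets borel" "sets G = sets borel"
    using F G by (auto simp: real_distribution.events_eq_borel)
  show ?thesis
    using assms(3)
  proof (induction rule: borel_measurable_induct)
    case (cong f g)
    then show ?case by (simp add: fun_eq_iff)
  next
    case (set A)
    then show ?case using F G by (simp add: emeasure_mixture)
  next
    case (mult u c)
    then show ?case by (simp add: nn_integral_cmult algebra_simps)
  next
    case (add u v)
    then show ?case by (simp add: nn_integral_add algebra_simps)
  next
    case (seq U)
    \<comment> \<open>Both weighted sequences increase, so the supremum of their sums splits into
      the sum of their suprema.\<close>
    have mono: "incseq (\<lambda>i. c * (\<integral>\<^sup>+x. U i x \<partial>M))" for c :: ennreal and M
      using \<open>incseq U\<close> by (intro monoI mult_left_mono nn_integral_mono) (auto dest: monoD le_funD)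
    have "(\<integral>\<^sup>+x. (SUP i. U i) x \<partial>mixture t F G)
        = (SUP i. ennreal (1 - t) * (\<integral>\<^sup>+x. U i x \<partial>F) + ennreal t * (\<integral>\<^sup>+x. U i x \<partial>G))"
      using seq by (simp add: nn_integral_monotone_convergence_SUP image_comp)
    also have "\<dots> = (SUP i. ennreal (1 - t) * (\<integral>\<^sup>+x. U i x \<partial>F)) + (SUP i. ennreal t * (\<integral>\<^sup>+x. U i x \<partial>G))"
      by (intro ennreal_SUP_add mono)
    finally show ?case
      using seq by (simp add: nn_integral_monotone_convergence_SUP image_comp SUP_mult_left_ennreal)
  qed
qed

text \<open>Apply the nonnegative case to the positive and negative parts of \<open>f\<close> and
  subtract.\<close>

lemma integral_mixture:
  fixes f :: "real \<Rightarrow> real"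
  assumes F: "real_distribution F" and G: "real_distribution G" and t: "0 \<le> t" "t \<le> 1"
    and f: "integrable F f" "integrable G f"
  shows "(\<integral>x. f x \<partial>mixture t F G) = (1 - t) * (\<integral>x. f x \<partial>F) + t * (\<integral>x. f x \<partial>G)"
proof -
  have [measurable_cong, simp]: "sets F = sets borel" "sets G = sets borel"
    using F G by (auto simp: real_distribution.events_eq_borel)
  have [measurable]: "f \<in> borel_measurable borel"
    using f(1) borel_measurable_integrable measurable_cong_sets by fastforce
  note fin = f[unfolded real_integrable_def]
  \<comment> \<open>Finiteness matters: \<open>enn2real\<close> sends \<open>\<infinity>\<close> to
    0 and is additive only on finite values.\<close>
  have enn2real: "enn2real (ennreal (1 - t) * a + ennreal t * b) = (1 - t) * enn2real a + t * enn2real b"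
    if "a \<noteq> \<infinity>" "b \<noteq> \<infinity>" for a b
    using that t by (cases a; cases b) (simp_all add: ennreal_mult[symmetric] ennreal_plus[symmetric] del: ennreal_plus)
  have nn: "(\<integral>\<^sup>+x. ennreal (g x) \<partial>mixture t F G)
      = ennreal (1 - t) * (\<integral>\<^sup>+x. ennreal (g x) \<partial>F) + ennreal t * (\<integral>\<^sup>+x. ennreal (g x) \<partial>G)"
    if [measurable]: "g \<in> borel_measurable borel" for g :: "real \<Rightarrow> real"
    by (rule nn_integral_mixture[OF F G]) measurable
  have "f \<in> borel_measurable (mixture t F G)"
    by measurable
  then have "integrable (mixture t F G) f"
    using fin by (simp add: real_integrable_def nn ennreal_mult_eq_top_iff)
  then show ?thesis
    using f fin by (simp add: real_lebesgue_integral_def nn enn2real right_diff_distrib)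
qed

text \<open>Subadditivity of the positive part; the inequality is strict when \<open>x\<close> and
  \<open>y\<close> have opposite nonzero signs. It makes the truncation of an affine functional
  convex.\<close>

lemma ennreal_add_le: "ennreal (x + y) \<le> ennreal x + ennreal y"
proof -
  have "ennreal (x + y) \<le> ennreal (max 0 x + max 0 y)"
    by (intro ennreal_leI) simp
  then show ?thesis
    by simp
qed

lemma fisher_info_scale_mixture_le:
  assumes F: "real_distribution F" and G: "real_distribution G" and t: "0 \<le> t" "t \<le> 1"
  shows "fisher_info_scale (mixture t F G)
    \<le> ennreal (1 - t) * fisher_info_scale F + ennreal t * fisher_info_scale G"
proof -
  have "ennreal (\<integral>x. score_gap \<phi> x \<partial>mixture t F G)
      \<le> ennreal (1 - t) * fisher_info_scale F + ennreal t * fisher_info_scale G"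
    if \<phi>: "\<phi> \<in> C_c1" for \<phi>
  proof -
    have "ennreal (\<integral>x. score_gap \<phi> x \<partial>mixture t F G)
        = ennreal ((1 - t) * (\<integral>x. score_gap \<phi> x \<partial>F) + t * (\<integral>x. score_gap \<phi> x \<partial>G))"
      by (simp add: integral_mixture assms integrable_bounded_continuous
          continuous_score_gap bounded_score_gap \<phi>)
    also have "\<dots> \<le> ennreal (1 - t) * ennreal (\<integral>x. score_gap \<phi> x \<partial>F)
        + ennreal t * ennreal (\<integral>x. score_gap \<phi> x \<partial>G)"
      \<comment> \<open>The integrals may be negative; nonnegativity of the weights alone lets
        \<open>ennreal\<close> distribute over the products.\<close>
      using t ennreal_add_le by (simp flip: ennreal_mult')
    also have "\<dots> \<le> ennreal (1 - t) * fisher_info_scale F + ennreal t * fisher_info_scale G"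
      using \<phi> by (intro add_mono mult_left_mono) (auto simp: fisher_info_scale_eq_SUP assms intro: SUP_upper)
    finally show ?thesis .
  qed
  then show ?thesis
    by (simp add: fisher_info_scale_eq_SUP[OF real_distribution_mixture[OF assms]] SUP_least)
qed

theorem proposition2p1:
  shows "lower_semicontinuous_map weak_topology fisher_info_scale \<and>
    (\<forall>F G. \<forall>t\<in>{0..1}. real_distribution F \<longrightarrow> real_distribution G \<longrightarrow>
       fisher_info_scale (mixture t F G)
         \<le> ennreal (1 - t) * fisher_info_scale F + ennreal t * fisher_info_scale G)"
  by (auto intro: lower_semicontinuous_fisher_info_scale fisher_info_scale_mixture_le)

end
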